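(* Let $n,p\in\mathbb N$, let $\lambda\ge\mu\ge 0$, $l\ge 0$, $\delta\ge0$ be real, and let $-1\le A<B\le 1$, $0<B\le 1$, $0\le\sigma<p$. If $f(z)=z^p-\sum_{k=n+p}^\infty|a_k|z^k$ is in the class $\widetilde{\mathcal P}_{\lambda,\mu,l}^{\delta+1}(A,B;\sigma,p)$, then $$\widetilde{\mathcal N}_{n,p}^{\eta}(f)\subset\widetilde{\mathcal P}_{\lambda,\mu,l}^{\delta}(A,B;\sigma,p),\qquad\text{where}\quad \eta:=\frac{n[\lambda\mu(n+p)+\lambda-\mu]}{n[\lambda\mu(n+p)+\lambda-\mu]+p+l}.$$ The result is the best possible in the sense that $\eta$ cannot be increased: for every $\eta^*>\eta$ there is $f\in\widetilde{\mathcal P}_{\lambda,\mu,l}^{\delta+1}(A,B;\sigma,p)$ such that $\widetilde{\mathcal N}_{n,p}^{\eta^*}(f)\not\subset\widetilde{\mathcal P}_{\lambda,\mu,l}^{\delta}(A,B;\sigma,p)$.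
   Context: $\mathbb N=\{1,2,3,\dots\}$ and $\mathcal U=\{z\in\mathbb C:|z|<1\}$. $\mathcal A(n,p)$ is the class of functions $f(z)=z^p+\sum_{k=n+p}^\infty a_kz^k$ that are analytic and $p$-valent in $\mathcal U$ ($p$-valent: no value is taken more than $p$ times in $\mathcal U$, counted with multiplicity, and some value is taken exactly $p$ times). For real $\delta\ge0$ and $k\ge n+p$ put $$\Phi_p^k(\delta,\lambda,\mu,l)=\left[\frac{(k-p)(\lambda\mu k+\lambda-\mu)+p+l}{p+l}\right]^{\delta},\qquad \mathcal J_p^\delta(\lambda,\mu,l)f(z)=z^p+\sum_{k=n+p}^\infty\Phi_p^k(\delta,\lambda,\mu,l)\,a_kz^k .$$ For $F,G$ analytic in $\mathcal U$, $F\prec G$ (subordination) means $F(z)=G(w(z))$ in $\mathcal U$ for some analytic $w:\mathcal U\to\mathbb C$ with $w(0)=0$, $|w(z)|<1$. For every real $\delta\ge0$, the class $\mathcal P_{\lambda,\mu,l}^{\delta}(A,B;\sigma,p)$ consists of all $f\in\mathcal A(n,p)$ with $$\frac1{p-\sigma}\left(\frac{[\mathcal J_p^\delta(\lambda,\mu,l)f(z)]'}{z^{p-1}}-\sigma\right)\prec\frac{1+Az}{1+Bz}\quad(z\in\mathcal U)$$ (the quotient by $z^{p-1}$ being extended analytically to $z=0$), and $\widetilde{\mathcal P}_{\lambda,\mu,l}^{\delta}(A,B;\sigma,p)$ is the subclass of those $f$ of the form $f(z)=z^p-\sum_{k=n+p}^\infty|a_k|z^k$. For $\eta\ge0$ and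 $f(z)=z^p-\sum_{k=n+p}^\infty|a_k|z^k\in\mathcal A(n,p)$, with the same fixed $\delta$ as in the claim, $$\widetilde{\mathcal N}_{n,p}^{\eta}(f)=\left\{g(z)=z^p-\sum_{k=n+p}^\infty|b_k|z^k\in\mathcal A(n,p):\ \sum_{k=n+p}^\infty\frac{k(1+B)\Phi_p^k(\delta,\lambda,\mu,l)}{(B-A)(p-\sigma)}\big||b_k|-|a_k|\big|\le\eta\right\}.$$
   Formalization: The sharpness claim is asserted except when A=-1, σ=0 and (δ=0 or λ=0); there it is false, since p-valence forces Σk|b_k|≤p, so the class P̃^δ contains every negative-coefficient function of A(n,p) and no neighbourhood leaves it. *)

theory Defs
  imports "HOL-Complex_Analysis.Complex_Analysis"
begin

abbreviation unit_disc :: "complex set" where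
  "unit_disc \<equiv> ball 0 1"

text \<open>
  Values are counted with multiplicity: for a non-constant holomorphic \<open>f\<close> the multiplicity
  of \<open>z\<close> as a solution of \<open>f z = c\<close> is the order of the zero of \<open>f - c\<close> at \<open>z\<close>.
  Finiteness is stated separately, because a sum over an infinite set is 0.
\<close>

definition num_preimages :: "(complex \<Rightarrow> complex) \<Rightarrow> complex \<Rightarrow> int" where
  "num_preimages f c = (\<Sum>z | z \<in> unit_disc \<and> f z = c. zorder (\<lambda>w. f w - c) z)"

definition p_valent :: "nat \<Rightarrow> (complex \<Rightarrow> complex) \<Rightarrow> bool" where
  "p_valent p f \<longleftrightarrow>
     (\<forall>c. finite {z \<in> unit_disc. f z = c} \<and> num_preimages f c \<le> int p) \<and>
     (\<exists>c. num_preimages f c = int p)"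

definition coeff0 :: "(complex \<Rightarrow> complex) \<Rightarrow> nat \<Rightarrow> complex" where
  "coeff0 f k = fps_nth (fps_expansion f 0) k"

text \<open>
  Functions have type \<open>complex \<Rightarrow> complex\<close>, but all classes below only constrain their
  values on the unit disc. A sum over \<open>k \<ge> n + p\<close> is written with \<open>k = n + p + j\<close>, \<open>j \<ge> 0\<close>.
\<close>

definition class_A :: "nat \<Rightarrow> nat \<Rightarrow> (complex \<Rightarrow> complex) set" where
  "class_A n p = {f. f holomorphic_on unit_disc \<and>
     (\<forall>z\<in>unit_disc. (\<lambda>j. coeff0 f (n + p + j) * z ^ (n + p + j)) sums (f z - z ^ p)) \<and>
     p_valent p f}"

text \<open>
  \<open>f(z) = z\<^sup>p - (\<Sum>k\<ge>n+p. |a\<^sub>k| z\<^sup>k)\<close> says that the \<open>k\<close>-th Taylor coefficient of \<open>f\<close> is \<open>-|a\<^sub>k|\<close>;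
  the number \<open>|a\<^sub>k|\<close> is then the modulus of that coefficient.
\<close>

definition class_A_neg :: "nat \<Rightarrow> nat \<Rightarrow> (complex \<Rightarrow> complex) set" where
  "class_A_neg n p = {f \<in> class_A n p.
     \<forall>z\<in>unit_disc. (\<lambda>j. of_real (cmod (coeff0 f (n + p + j))) * z ^ (n + p + j)) sums (z ^ p - f z)}"

definition Phi :: "nat \<Rightarrow> nat \<Rightarrow> real \<Rightarrow> real \<Rightarrow> real \<Rightarrow> real \<Rightarrow> real" where
  "Phi p k \<delta> lam mu l =
     (((real k - real p) * (lam * mu * real k + lam - mu) + real p + l) / (real p + l)) powr \<delta>"

definition J_op :: "nat \<Rightarrow> nat \<Rightarrow> real \<Rightarrow> real \<Rightarrow> real \<Rightarrow> real \<Rightarrow> (complex \<Rightarrow> complex) \<Rightarrow> complex \<Rightarrow> complex" where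
  "J_op n p \<delta> lam mu l f z =
     z ^ p + (\<Sum>j. of_real (Phi p (n + p + j) \<delta> lam mu l) * coeff0 f (n + p + j) * z ^ (n + p + j))"

definition subordinate :: "(complex \<Rightarrow> complex) \<Rightarrow> (complex \<Rightarrow> complex) \<Rightarrow> bool" where
  "subordinate F G \<longleftrightarrow> (\<exists>w. w holomorphic_on unit_disc \<and> w 0 = 0 \<and>
     (\<forall>z\<in>unit_disc. cmod (w z) < 1 \<and> F z = G (w z)))"

text \<open>\<open>remove_sings\<close> extends the quotient by \<open>z\<^bsup>p-1\<^esup>\<close> analytically to \<open>z = 0\<close>.\<close>

definition class_P ::
  "nat \<Rightarrow> nat \<Rightarrow> real \<Rightarrow> real \<Rightarrow> real \<Rightarrow> real \<Rightarrow> real \<Rightarrow> real \<Rightarrow> real \<Rightarrow> (complex \<Rightarrow> complex) set" where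
  "class_P n p lam mu l \<delta> A B \<sigma> = {f \<in> class_A n p.
     subordinate
       (\<lambda>z. 1 / (of_nat p - of_real \<sigma>) *
            (remove_sings (\<lambda>u. deriv (J_op n p \<delta> lam mu l f) u / u ^ (p - 1)) z - of_real \<sigma>))
       (\<lambda>z. (1 + of_real A * z) / (1 + of_real B * z))}"

definition class_P_neg ::
  "nat \<Rightarrow> nat \<Rightarrow> real \<Rightarrow> real \<Rightarrow> real \<Rightarrow> real \<Rightarrow> real \<Rightarrow> real \<Rightarrow> real \<Rightarrow> (complex \<Rightarrow> complex) set" where
  "class_P_neg n p lam mu l \<delta> A B \<sigma> = class_P n p lam mu l \<delta> A B \<sigma> \<inter> class_A_neg n p"

definition nbhd_term ::
  "nat \<Rightarrow> real \<Rightarrow> real \<Rightarrow> real \<Rightarrow> real \<Rightarrow> real \<Rightarrow> real \<Rightarrow> real \<Rightarrow>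
   (complex \<Rightarrow> complex) \<Rightarrow> (complex \<Rightarrow> complex) \<Rightarrow> nat \<Rightarrow> real" where
  "nbhd_term p lam mu l \<delta> A B \<sigma> f g k =
     real k * (1 + B) * Phi p k \<delta> lam mu l / ((B - A) * (real p - \<sigma>)) *
     \<bar>cmod (coeff0 g k) - cmod (coeff0 f k)\<bar>"

definition nbhd ::
  "nat \<Rightarrow> nat \<Rightarrow> real \<Rightarrow> real \<Rightarrow> real \<Rightarrow> real \<Rightarrow> real \<Rightarrow> real \<Rightarrow> real \<Rightarrow> real \<Rightarrow>
   (complex \<Rightarrow> complex) \<Rightarrow> (complex \<Rightarrow> complex) set" where
  "nbhd n p lam mu l \<delta> A B \<sigma> \<eta> f = {g \<in> class_A_neg n p.
     summable (\<lambda>j. nbhd_term p lam mu l \<delta> A B \<sigma> f g (n + p + j)) \<and>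
     (\<Sum>j. nbhd_term p lam mu l \<delta> A B \<sigma> f g (n + p + j)) \<le> \<eta>}"

text \<open>
  Sharpness of the neighbourhood radius needs an exclusion: it fails when \<open>A = -1\<close>, \<open>\<sigma> = 0\<close> and
  \<open>Phi p k \<delta> lam mu l = 1\<close> for all \<open>k\<close>, i.e. \<open>\<delta> = 0\<close> or \<open>lam = 0\<close> (the latter forces \<open>mu = 0\<close>).
  There \<open>class_P_neg n p lam mu l \<delta> A B \<sigma>\<close> is all of \<open>class_A_neg n p\<close>:
  \<open>p\<close>-valence of \<open>z\<^sup>p - (\<Sum>k\<ge>n+p. |b\<^sub>k| z\<^sup>k)\<close> forces \<open>(\<Sum>k\<ge>n+p. k |b\<^sub>k|) \<le> p\<close>, which implies the
  subordination. Hence no neighbourhood, however large, leaves the class.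
\<close>

end

theory Submission
  imports Defs
begin

text \<open>
  For a function with negative coefficients, membership in the class of exponent \<open>\<delta>\<close> is
  equivalent to a weighted \<open>\<ell>\<^sub>1\<close> bound: the sum of \<open>w\<^sub>k |a\<^sub>k|\<close> is at most \<open>1\<close>, where \<open>w\<^sub>k\<close> are the
  weights that also measure the distance in \<open>nbhd\<close> (\<open>class_P_neg_iff_coefficients\<close>). The bound
  is necessary because on the positive radius all terms have the same sign, and sufficient by the
  triangle inequality (\<open>subordinate_negative_series_iff\<close>).

  Passing from \<open>\<delta>\<close> to \<open>\<delta> + 1\<close> multiplies \<open>w\<^sub>k\<close> by the base of \<open>Phi\<close>, which increases with \<open>k\<close>;
  let \<open>R\<close> be its value at \<open>m = n + p\<close>. A function of the class of exponent \<open>\<delta> + 1\<close> thus has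
  weighted norm at most \<open>1 / R\<close>, and \<open>\<eta>\<close> is exactly \<open>1 - 1 / R\<close>, so the inclusion is the triangle
  inequality for the weighted norm.

  For sharpness, the function \<open>z\<^sup>p - a z\<^sup>m\<close> with \<open>w\<^sub>m a = 1 / R\<close> is extremal, and \<open>z\<^sup>p - b z\<^sup>m\<close> with
  \<open>w\<^sub>m b\<close> slightly larger than \<open>1\<close> is a neighbour outside the class. The point that needs work is that
  the latter is \<open>p\<close>-valent. This holds whenever \<open>m b \<le> p\<close> (\<open>p_valent_binomial\<close>), because the function
  is then the \<open>p\<close>-th power of a univalent function, recognised by the positive real part of
  its derivative. Since \<open>m / w\<^sub>m = (B - A) (p - \<sigma>) / ((1 + B) \<Phi>\<^sub>m)\<close> is at most \<open>p\<close>, with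
  equality only if \<open>A = -1\<close>, \<open>\<sigma> = 0\<close> and \<open>\<Phi>\<^sub>m = 1\<close>, there is room for such a \<open>b\<close> in all
  other cases.
\<close>

section \<open>Valence of two-term polynomials\<close>

lemma holomorphic_onI_DERIV:
  assumes "\<And>z. z \<in> S \<Longrightarrow> (f has_field_derivative f' z) (at z)"
  shows "f holomorphic_on S"
  unfolding holomorphic_on_def field_differentiable_def
  by (intro ballI exI, rule has_field_derivative_at_within, rule assms)

text \<open>
  The Noshiro--Warschawski criterion. If \<open>f w = f z\<close>, the mean value theorem for the real part,
  applied to \<open>f\<close> divided by the direction \<open>z - w\<close>, gives a point of the segment where
  \<open>Re f'\<close> vanishes.
\<close>

lemma Re_deriv_pos_imp_inj_on:
  assumes "convex S"
    and der: "\<And>z. z \<in> S \<Longrightarrow> (f has_field_derivative f' z) (at z)"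
    and pos: "\<And>z. z \<in> S \<Longrightarrow> 0 < Re (f' z)"
  shows "inj_on f S"
proof (rule inj_onI, rule ccontr)
  fix w z assume wz: "w \<in> S" "z \<in> S" "f w = f z" "w \<noteq> z"
  have seg: "closed_segment w z \<subseteq> S"
    using assms(1) wz(1,2) by (simp add: closed_segment_subset)
  have "((\<lambda>u. f u / (z - w)) has_field_derivative f' u / (z - w)) (at u)"
    if "u \<in> closed_segment w z" for u
    using der[of u] that seg by (intro DERIV_cdivide) auto
  then obtain u where u: "u \<in> closed_segment w z"
    and eq: "Re (f z / (z - w)) - Re (f w / (z - w)) = Re (f' u / (z - w) * (z - w))"
    using complex_mvt_line[of w z "\<lambda>u. f u / (z - w)" "\<lambda>u. f' u / (z - w)"] by blast
  have "Re (f' u) = 0"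
    using eq wz by simp
  then show False
    using pos[of u] u seg by auto
qed

text \<open>
  The argument \<open>\<alpha>\<close> of \<open>1 - v\<close> lies strictly between \<open>- pi / 2\<close> and \<open>pi / 2\<close>. Shrinking \<open>v\<close> to \<open>t v\<close> keeps
  the sign of the argument and does not increase its modulus, so the argument \<open>\<alpha> - s \<beta>\<close> of
  the product stays between \<open>0\<close> and \<open>\<alpha>\<close>. This is what makes the \<open>p\<close>-th root of
  \<open>z\<^sup>p - b z\<^bsup>n+p\<^esup>\<close> have a derivative with positive real part.
\<close>

lemma Re_one_minus_mult_powr_pos:
  fixes v :: complex and s t :: real
  assumes v: "cmod v < 1" and t: "0 \<le> t" "t \<le> 1" and s: "0 \<le> s" "s \<le> 1"
  shows "0 < Re ((1 - v) * (1 - of_real t * v) powr of_real (- s))"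
proof -
  define x where "x = 1 - Re v"
  define y where "y = - Im v"
  have x: "x > 0"
    using v complex_Re_le_cmod[of v] by (simp add: x_def)
  define d where "d = 1 - t + t * x"
  have d: "d > 0"
    unfolding d_def using x t by (cases "t = 0") (auto intro!: add_nonneg_pos)
  have nz: "1 - v \<noteq> 0" "1 - of_real t * v \<noteq> 0"
    using x d by (auto simp: x_def d_def complex_eq_iff algebra_simps)
  define \<alpha> where "\<alpha> = Im (Ln (1 - v))"
  define \<beta> where "\<beta> = Im (Ln (1 - of_real t * v))"
  have Re_d: "Re (1 - of_real t * v) = d"
    by (simp add: d_def x_def algebra_simps)
  \<comment> \<open>Both numbers lie in the right half plane, so their arguments are arctangents of slopes.\<close>
  have \<alpha>: "\<alpha> = arctan (y / x)"
    using nz x by (simp add: \<alpha>_def Im_Ln_eq x_def y_def)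
  have \<beta>: "\<beta> = arctan (t * y / d)"
    using nz d Re_d by (simp add: \<beta>_def Im_Ln_eq y_def)
  have tx: "t * x \<le> d"
    using t by (simp add: d_def)
  have bnd: "\<bar>\<alpha> - s * \<beta>\<bar> \<le> \<bar>\<alpha>\<bar>"
  proof (cases "y \<ge> 0")
    case True
    have "t * y / d \<le> y / x"
      using mult_right_mono[OF tx True] x d by (simp add: field_simps)
    then have "0 \<le> \<beta>" "\<beta> \<le> \<alpha>"
      using True t d by (auto simp: \<alpha> \<beta> arctan_le_iff)
    moreover have "s * \<beta> \<le> 1 * \<beta>" "0 \<le> s * \<beta>"
      using s \<open>0 \<le> \<beta>\<close> by (auto intro: mult_left_le_one_le)
    ultimately show ?thesis by linarith
  next
    case False
    have "y / x \<le> t * y / d"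
      using mult_right_mono_neg[OF tx, of y] False x d by (simp add: field_simps)
    moreover have "t * y / d \<le> 0"
      using False t d by (simp add: mult_nonneg_nonpos divide_nonpos_pos)
    ultimately have "\<beta> \<le> 0" "\<alpha> \<le> \<beta>"
      by (auto simp: \<alpha> \<beta> arctan_le_iff)
    moreover have "1 * \<beta> \<le> s * \<beta>" "s * \<beta> \<le> 0"
      using s \<open>\<beta> \<le> 0\<close> mult_right_mono_neg[of s 1 \<beta>] by (auto simp: mult_nonneg_nonpos)
    ultimately show ?thesis by linarith
  qed
  have "\<bar>\<alpha>\<bar> < pi / 2"
    using arctan_bounded[of "y / x"] by (auto simp: \<alpha>)
  with bnd have "\<bar>\<alpha> - s * \<beta>\<bar> < pi / 2"
    by linarith
  then have cos: "0 < cos (\<alpha> - s * \<beta>)"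
    by (intro cos_gt_zero_pi) linarith+
  have "(1 - v) * (1 - of_real t * v) powr of_real (- s)
      = exp (Ln (1 - v) - of_real s * Ln (1 - of_real t * v))"
    using nz by (simp add: powr_def exp_diff exp_minus divide_inverse)
  then show ?thesis
    using cos by (simp add: Re_exp \<alpha>_def \<beta>_def)
qed

text \<open>
  Univalence of \<open>\<phi>\<close> counts the solutions of \<open>\<phi>\<^sup>p = c\<close>: for \<open>c \<noteq> 0\<close> each of the \<open>p\<close> roots of \<open>c\<close> is
  attained at most once, and every solution is simple because neither \<open>\<phi>\<close> nor \<open>\<phi>'\<close> vanishes
  there; for \<open>c = 0\<close> the only solution is the origin, with multiplicity \<open>p\<close>.
\<close>

lemma p_valent_power_of_univalent:
  fixes \<phi> :: "complex \<Rightarrow> complex"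
  assumes p: "p \<ge> 1" and hol: "\<phi> holomorphic_on unit_disc" and inj: "inj_on \<phi> unit_disc"
    and \<phi>0: "\<phi> 0 = 0" and f: "\<And>z. z \<in> unit_disc \<Longrightarrow> f z = \<phi> z ^ p"
  shows "p_valent p f"
proof -
  have reg: "deriv \<phi> z \<noteq> 0" if "z \<in> unit_disc" for z
    using holomorphic_injective_imp_regular[OF hol open_ball inj that] .
  have \<phi>nz: "\<phi> z \<noteq> 0" if "z \<in> unit_disc" "z \<noteq> 0" for z
    using inj_onD[OF inj, of z 0] that \<phi>0 by auto
  have holf: "f holomorphic_on unit_disc"
    by (rule holomorphic_transform[OF holomorphic_on_power[OF hol, of p]]) (simp add: f)
  have fib0: "{z \<in> unit_disc. f z = 0} = {0}"
  proof -
    have "f z = 0 \<longleftrightarrow> z = 0" if "z \<in> unit_disc" for z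
      using \<phi>nz[OF that] f[OF that] \<phi>0 p by (cases "z = 0") auto
    then show ?thesis
      by auto
  qed
  have ev: "eventually (\<lambda>z. z \<in> unit_disc - {0}) (at (0::complex))"
    by (rule eventually_at_in_open) auto
  have an: "\<phi> analytic_on {0}"
    using hol by (meson analytic_on_open analytic_on_subset open_ball centre_in_ball empty_subsetI insert_subset zero_less_one)
  have "zorder \<phi> 0 = 1"
    by (rule zorder_zero_eqI[OF hol open_ball]) (use reg[of 0] \<phi>0 in auto)
  moreover have "zorder f 0 = zorder (\<lambda>z. \<phi> z ^ p) 0"
    by (rule zorder_cong) (use ev in \<open>auto elim!: eventually_mono simp: f\<close>)
  moreover have "frequently (\<lambda>z. \<phi> z \<noteq> 0) (at 0)"
    by (rule eventually_frequently) (use ev \<phi>nz in \<open>auto elim!: eventually_mono\<close>)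
  ultimately have ord0: "zorder f 0 = int p"
    using zorder_power[of \<phi> 0 p] analytic_on_imp_meromorphic_on[OF an] by simp
  have n0: "num_preimages f 0 = int p"
    unfolding num_preimages_def fib0 by (simp add: ord0)
  have c: "finite {z \<in> unit_disc. f z = c} \<and> num_preimages f c \<le> int p" for c
  proof (cases "c = 0")
    case True
    then show ?thesis
      using fib0 n0 by simp
  next
    case False
    let ?Z = "{z \<in> unit_disc. f z = c}"
    have sub: "\<phi> ` ?Z \<subseteq> {w. w ^ p = c}"
      using f by auto
    have injZ: "inj_on \<phi> ?Z"
      by (rule inj_on_subset[OF inj]) auto
    have fin: "finite {w::complex. w ^ p = c}"
      using p by (intro finite_nth_roots) auto
    have finZ: "finite ?Z"
      using inj_on_finite[OF injZ sub fin] .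
    have card: "card ?Z \<le> p"
      using card_inj_on_le[OF injZ sub fin] card_nth_roots[OF False, of p] p by simp
    have "zorder (\<lambda>w. f w - c) z = 1" if z: "z \<in> ?Z" for z
    proof -
      have zD: "z \<in> unit_disc"
        using z by simp
      have "(\<phi> has_field_derivative deriv \<phi> z) (at z)"
        using holomorphic_derivI[OF hol open_ball zD] .
      then have "((\<lambda>w. \<phi> w ^ p - c) has_field_derivative of_nat p * \<phi> z ^ (p - 1) * deriv \<phi> z) (at z)"
        by (auto intro!: derivative_eq_intros)
      then have "((\<lambda>w. f w - c) has_field_derivative of_nat p * \<phi> z ^ (p - 1) * deriv \<phi> z) (at z)"
        by (rule has_field_derivative_transform_within_open[OF _ open_ball zD]) (use f in auto)
      then have "deriv (\<lambda>w. f w - c) z = of_nat p * \<phi> z ^ (p - 1) * deriv \<phi> z"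
        by (rule DERIV_imp_deriv)
      moreover have "\<phi> z \<noteq> 0"
        using z f[of z] False p by auto
      ultimately have "deriv (\<lambda>w. f w - c) z \<noteq> 0"
        using reg[OF zD] p by simp
      then show ?thesis
        by (intro zorder_zero_eqI[OF _ open_ball zD]) (use z holf in \<open>auto intro!: holomorphic_intros\<close>)
    qed
    then have "num_preimages f c = int (card ?Z)"
      by (simp add: num_preimages_def)
    then show ?thesis
      using finZ card by simp
  qed
  show ?thesis
    unfolding p_valent_def using c n0 by blast
qed

text \<open>
  A holomorphic \<open>p\<close>-th root on the disc is \<open>\<phi> z = z (1 - b z\<^sup>n)\<^bsup>1/p\<^esup>\<close>, and
  \<open>\<phi>' z = (1 - \<kappa> b z\<^sup>n) (1 - b z\<^sup>n)\<^bsup>1/p-1\<^esup>\<close> with \<open>\<kappa> = (n + p) / p\<close>. The hypothesis on \<open>b\<close> says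
  that \<open>\<kappa> b \<le> 1\<close>, hence \<open>Re \<phi>' > 0\<close> and \<open>\<phi>\<close> is univalent.
\<close>

lemma p_valent_binomial:
  fixes b :: real
  assumes n: "n \<ge> 1" and p: "p \<ge> 1" and b: "0 \<le> b" "real (n + p) * b \<le> real p"
  shows "p_valent p (\<lambda>z. z ^ p - of_real b * z ^ (n + p))"
proof -
  define \<kappa> where "\<kappa> = real (n + p) / real p"
  define s where "s = 1 - 1 / real p"
  define h :: "complex \<Rightarrow> complex" where "h z = 1 - of_real b * z ^ n" for z
  define \<phi> :: "complex \<Rightarrow> complex" where "\<phi> z = z * h z powr of_real (1 / real p)" for z
  define \<phi>' :: "complex \<Rightarrow> complex" where "\<phi>' z = (1 - of_real (\<kappa> * b) * z ^ n) * h z powr of_real (- s)" for z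
  have \<kappa>: "1 \<le> \<kappa>" "0 \<le> \<kappa> * b" "\<kappa> * b \<le> 1"
    using p b by (auto simp: \<kappa>_def field_simps)
  have s: "0 \<le> s" "s \<le> 1"
    using p by (auto simp: s_def field_simps)
  have zn: "cmod (z ^ n) < 1" if "z \<in> unit_disc" for z :: complex
    using that n power_strict_mono[of "cmod z" 1 n] by (simp add: norm_power)
  have v: "cmod (of_real (\<kappa> * b) * z ^ n) < 1" if "z \<in> unit_disc" for z :: complex
  proof -
    have "cmod (of_real (\<kappa> * b) * z ^ n) = \<kappa> * b * cmod (z ^ n)"
      using \<kappa> b by (simp add: norm_mult)
    also have "\<dots> \<le> cmod (z ^ n)"
      using \<kappa> by (intro mult_left_le_one_le) auto
    finally show ?thesis using zn[OF that] by simp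
  qed
  have Reh: "0 < Re (h z)" if "z \<in> unit_disc" for z
  proof -
    have "b \<le> \<kappa> * b"
      using mult_right_mono[OF \<kappa>(1) b(1)] by simp
    then have "cmod (of_real b * z ^ n) \<le> cmod (of_real (\<kappa> * b) * z ^ n)"
      using \<kappa> b by (simp add: norm_mult mult_right_mono)
    then show ?thesis
      using v[OF that] complex_Re_le_cmod[of "of_real b * z ^ n"] by (simp add: h_def)
  qed
  have hnz: "h z \<noteq> 0" if "z \<in> unit_disc" for z
    using Reh[OF that] by auto
  have hR: "h z \<notin> \<real>\<^sub>\<le>\<^sub>0" if "z \<in> unit_disc" for z
    using Reh[OF that] by (auto simp: complex_nonpos_Reals_iff)
  have der: "(\<phi> has_field_derivative \<phi>' z) (at z)" if z: "z \<in> unit_disc" for z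
  proof -
    have pw: "h z powr of_real (1 / real p) = h z * h z powr of_real (- s)"
      using hnz[OF z] by (simp add: s_def powr_diff powr_minus field_simps)
    have zz: "z * z ^ (n - 1) = z ^ n"
      using n by (metis power_eq_if not_one_le_zero)
    have dh: "(h has_field_derivative (- of_real b * (of_nat n * z ^ (n - 1)))) (at z)"
      unfolding h_def by (auto intro!: derivative_eq_intros)
    have "((\<lambda>w. h w powr of_real (1 / real p)) has_field_derivative
        (of_real (1 / real p) * h z powr (of_real (1 / real p) - 1)) * (- of_real b * (of_nat n * z ^ (n - 1)))) (at z)"
      using DERIV_chain2[OF has_field_derivative_powr[OF hR[OF z]] dh] .
    moreover have "of_real (1 / real p) - 1 = (of_real (- s) :: complex)"
      by (simp add: s_def)
    ultimately have "((\<lambda>w. h w powr of_real (1 / real p)) has_field_derivative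
        (of_real (1 / real p) * h z powr of_real (- s)) * (- of_real b * (of_nat n * z ^ (n - 1)))) (at z)"
      by simp
    from DERIV_mult[OF DERIV_ident this]
    have "(\<phi> has_field_derivative
       h z powr of_real (1 / real p) + z * ((of_real (1 / real p) * h z powr of_real (- s)) * (- of_real b * (of_nat n * z ^ (n - 1))))) (at z)"
      unfolding \<phi>_def by (simp add: algebra_simps)
    also have "h z powr of_real (1 / real p) + z * ((of_real (1 / real p) * h z powr of_real (- s)) * (- of_real b * (of_nat n * z ^ (n - 1))))
       = (h z - of_real (1 / real p) * of_real b * of_nat n * (z * z ^ (n - 1))) * h z powr of_real (- s)"
      unfolding pw by (simp add: algebra_simps)
    also have "\<dots> = \<phi>' z"
      unfolding zz \<phi>'_def using p by (simp add: h_def \<kappa>_def field_simps)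
    finally show ?thesis .
  qed
  have pos: "0 < Re (\<phi>' z)" if z: "z \<in> unit_disc" for z
  proof -
    have "h z = 1 - of_real (1 / \<kappa>) * (of_real (\<kappa> * b) * z ^ n)"
      using \<kappa>(1) by (simp add: h_def)
    then show ?thesis
      using Re_one_minus_mult_powr_pos[OF v[OF z], of "1 / \<kappa>" s] \<kappa>(1) s by (simp add: \<phi>'_def)
  qed
  have inj: "inj_on \<phi> unit_disc"
    by (rule Re_deriv_pos_imp_inj_on[OF convex_ball der pos])
  have hol: "\<phi> holomorphic_on unit_disc"
    by (rule holomorphic_onI_DERIV[OF der])
  show ?thesis
  proof (rule p_valent_power_of_univalent[OF p hol inj])
    show "\<phi> 0 = 0" by (simp add: \<phi>_def)
    fix z :: complex assume "z \<in> unit_disc"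
    then have "(h z powr of_real (1 / real p)) ^ p = h z"
      using hnz[of z] p by (simp add: powr_def exp_of_nat_mult[symmetric])
    then have "\<phi> z ^ p = z ^ p * h z"
      by (simp only: \<phi>_def power_mult_distrib)
    then show "z ^ p - of_real b * z ^ (n + p) = \<phi> z ^ p"
      by (simp add: h_def power_add algebra_simps)
  qed
qed

section \<open>Taylor coefficients\<close>

lemma coeff0_eqI:
  assumes "\<And>z. z \<in> unit_disc \<Longrightarrow> (\<lambda>k. c k * z ^ k) sums f z"
  shows "coeff0 f k = c k"
proof -
  have "eventually (\<lambda>z. z \<in> unit_disc) (nhds (0::complex))"
    by (rule eventually_nhds_in_open) auto
  then have "f has_fps_expansion Abs_fps c"
    by (intro has_fps_expansionI) (auto elim!: eventually_mono intro: assms)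
  then show ?thesis
    by (simp add: coeff0_def fps_expansion_eqI)
qed

text \<open>
  The class \<open>class_A\<close> describes a function by the series of \<open>f z - z\<^sup>p\<close> starting at the power
  \<open>m = n + p\<close>; this is the uniqueness of power series in that format.
\<close>

lemma coeff0_eqI_tail:
  assumes m: "p < m"
    and "\<And>z. z \<in> unit_disc \<Longrightarrow> (\<lambda>j. c (m + j) * z ^ (m + j)) sums (f z - z ^ p)"
  shows "coeff0 f (m + j) = c (m + j)"
proof -
  define C where "C k = (if k = p then 1 else if k < m then 0 else c k)" for k
  have "(\<lambda>k. C k * z ^ k) sums f z" if z: "z \<in> unit_disc" for z
  proof -
    have "(\<Sum>k<m. C k * z ^ k) = (\<Sum>k<m. if k = p then z ^ p else 0)"
      by (intro sum.cong) (auto simp: C_def)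
    also have "\<dots> = z ^ p"
      using m by simp
    finally have eq: "(\<Sum>k<m. C k * z ^ k) = z ^ p" .
    have "(\<lambda>k. C (k + m) * z ^ (k + m)) sums (f z - z ^ p)"
      using assms(2)[OF z] m by (simp add: C_def add.commute)
    then show ?thesis
      using sums_iff_shift[of "\<lambda>k. C k * z ^ k" m] by (simp add: eq)
  qed
  then have "coeff0 f (m + j) = C (m + j)"
    by (rule coeff0_eqI)
  then show ?thesis
    using m by (simp add: C_def)
qed

text \<open>
  These polynomials supply both the extremal function and its neighbour outside the class.
\<close>

lemma binomial_in_class_A_neg:
  fixes b :: real
  assumes n: "n \<ge> 1" and p: "p \<ge> 1" and b: "0 \<le> b" "real (n + p) * b \<le> real p"
  defines "f \<equiv> (\<lambda>z::complex. z ^ p - of_real b * z ^ (n + p))"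
  shows "f \<in> class_A_neg n p"
    and "coeff0 f (n + p + j) = (if j = 0 then - of_real b else 0)"
proof -
  define c :: "nat \<Rightarrow> complex" where "c k = (if k = n + p then - of_real b else 0)" for k
  have s: "(\<lambda>j. c (n + p + j) * z ^ (n + p + j)) sums (f z - z ^ p)" for z
  proof -
    have "(\<lambda>j. if j = 0 then c (n + p + j) * z ^ (n + p + j) else 0) sums (c (n + p + 0) * z ^ (n + p + 0))"
      by (rule sums_single)
    moreover have "(\<lambda>j. if j = 0 then c (n + p + j) * z ^ (n + p + j) else 0) = (\<lambda>j. c (n + p + j) * z ^ (n + p + j))"
      by (auto simp: c_def)
    ultimately show ?thesis
      by (simp add: f_def c_def)
  qed
  have co: "coeff0 f (n + p + j) = c (n + p + j)" for j
    by (rule coeff0_eqI_tail[of p]) (use n s in auto)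
  then show "coeff0 f (n + p + j) = (if j = 0 then - of_real b else 0)"
    by (simp add: c_def)
  have neg: "(\<lambda>j. of_real (cmod (coeff0 f (n + p + j))) * z ^ (n + p + j)) sums (z ^ p - f z)" for z
  proof -
    have "of_real (cmod (coeff0 f (n + p + j))) * z ^ (n + p + j) = - (c (n + p + j) * z ^ (n + p + j))" for j
      using b by (simp add: co c_def)
    then show ?thesis
      using sums_minus[OF s[of z]] by simp
  qed
  have "p_valent p f"
    unfolding f_def by (rule p_valent_binomial[OF n p b])
  then show "f \<in> class_A_neg n p"
    using s co neg by (auto simp: class_A_neg_def class_A_def f_def intro!: holomorphic_intros)
qed

section \<open>Power series on the unit disc\<close>

text \<open>
  Differentiating a power series preserves its disc of convergence; multiplication of the
  coefficients by \<open>j + m\<close> amounts to \<open>z d/dz + m\<close>, which can be iterated.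
\<close>

lemma summable_power_mult_in_disc:
  fixes c :: "nat \<Rightarrow> complex"
  assumes "\<And>z. cmod z < 1 \<Longrightarrow> summable (\<lambda>j. c j * z ^ j)" and "cmod z < 1"
  shows "summable (\<lambda>j. of_nat (j + m) ^ N * c j * z ^ j)"
  using assms(2)
proof (induction N arbitrary: z)
  case 0
  then show ?case using assms(1) by simp
next
  case (Suc N)
  let ?d = "\<lambda>j. of_nat (j + m) ^ N * c j"
  have "summable (\<lambda>j. diffs ?d j * z ^ j)"
    using Suc by (intro termdiff_converges[of z 1]) auto
  then have "summable (\<lambda>j. of_nat j * ?d j * z ^ (j - Suc 0))"
    using diffs_equiv[of ?d z] sums_summable by blast
  then have "summable (\<lambda>j. z * (of_nat j * ?d j * z ^ (j - Suc 0)) + of_nat m * (?d j * z ^ j))"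
    by (intro summable_add summable_mult Suc)
  also have "(\<lambda>j. z * (of_nat j * ?d j * z ^ (j - Suc 0)) + of_nat m * (?d j * z ^ j))
     = (\<lambda>j. of_nat (j + m) ^ Suc N * c j * z ^ j)"
  proof
    fix j
    show "z * (of_nat j * ?d j * z ^ (j - Suc 0)) + of_nat m * (?d j * z ^ j)
      = of_nat (j + m) ^ Suc N * c j * z ^ j"
      by (cases j) (simp_all add: algebra_simps)
  qed
  finally show ?case .
qed

text \<open>
  The multipliers \<open>Phi\<close> of the operator \<open>J_op\<close> are real powers, but they are dominated by integer
  powers of the index, so the operator does not shrink the disc of convergence.
\<close>

lemma summable_poly_growth_mult_in_disc:
  fixes c \<gamma> :: "nat \<Rightarrow> complex" and K :: real
  assumes c: "\<And>z. cmod z < 1 \<Longrightarrow> summable (\<lambda>j. c j * z ^ j)"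
    and \<gamma>: "\<And>j. cmod (\<gamma> j) \<le> K * real (j + m) ^ N" and z: "cmod z < 1"
  shows "summable (\<lambda>j. \<gamma> j * c j * z ^ j)"
proof -
  obtain r where r: "cmod z < r" "r < 1"
    using dense[OF z] by blast
  have r0: "0 < r"
    using r(1) norm_ge_zero[of z] by linarith
  let ?d = "\<lambda>j. of_nat (j + m) ^ N * c j"
  have "summable (\<lambda>j. ?d j * (of_real r) ^ j)"
    using r r0 by (intro summable_power_mult_in_disc c) auto
  then have "summable (\<lambda>j. norm (?d j * z ^ j))"
    using powser_insidea[of ?d "of_real r" z] r r0 by simp
  then have "summable (\<lambda>j. K * norm (?d j * z ^ j))"
    by (rule summable_mult)
  then show ?thesis
  proof (rule summable_comparison_test'[of _ 0])
    fix j
    have "norm (\<gamma> j * c j * z ^ j) = cmod (\<gamma> j) * (cmod (c j) * cmod (z ^ j))"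
      by (simp add: norm_mult)
    also have "\<dots> \<le> K * real (j + m) ^ N * (cmod (c j) * cmod (z ^ j))"
      by (intro mult_right_mono \<gamma>) auto
    also have "\<dots> = K * norm (?d j * z ^ j)"
      by (simp add: norm_mult norm_power flip: of_nat_add)
    finally show "norm (\<gamma> j * c j * z ^ j) \<le> K * norm (?d j * z ^ j)" .
  qed
qed

lemma DERIV_power_series_shifted:
  fixes c :: "nat \<Rightarrow> complex"
  assumes c: "\<And>z. cmod z < 1 \<Longrightarrow> summable (\<lambda>j. c j * z ^ j)" and z: "cmod z < 1" and m: "m \<ge> 1"
  shows "((\<lambda>w. \<Sum>j. c j * w ^ (m + j)) has_field_derivative
           z ^ (m - 1) * (\<Sum>j. of_nat (m + j) * c j * z ^ j)) (at z)"
proof -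
  obtain r where r: "cmod z < r" "r < 1"
    using dense[OF z] by blast
  have r0: "0 < r"
    using r(1) norm_ge_zero[of z] by linarith
  define U where "U w = (\<Sum>j. c j * w ^ j)" for w
  define U' where "U' = (\<Sum>j. diffs c j * z ^ j)"
  have dU: "(U has_field_derivative U') (at z)"
    unfolding U_def U'_def using r r0 by (intro termdiffs_strong[of _ "of_real r"] c) auto
  have shift: "(\<Sum>j. c j * w ^ (m + j)) = w ^ m * U w" if "w \<in> unit_disc" for w
    using suminf_mult[OF c, of w "w ^ m"] that by (simp add: U_def power_add algebra_simps)
  have "summable (\<lambda>j. diffs c j * z ^ j)"
    using z by (intro termdiff_converges[of z 1] c) auto
  then have "(\<lambda>j. of_nat j * c j * z ^ (j - Suc 0)) sums U'"
    unfolding U'_def by (rule diffs_equiv)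
  from sums_add[OF sums_mult[OF this, of z] sums_mult[OF summable_sums[OF c[OF z]], of "of_nat m"]]
  have "(\<lambda>j. z * (of_nat j * c j * z ^ (j - Suc 0)) + of_nat m * (c j * z ^ j)) sums (z * U' + of_nat m * U z)"
    by (simp add: U_def)
  also have "(\<lambda>j. z * (of_nat j * c j * z ^ (j - Suc 0)) + of_nat m * (c j * z ^ j))
     = (\<lambda>j. of_nat (m + j) * c j * z ^ j)"
  proof
    fix j
    show "z * (of_nat j * c j * z ^ (j - Suc 0)) + of_nat m * (c j * z ^ j) = of_nat (m + j) * c j * z ^ j"
      by (cases j) (simp_all add: algebra_simps)
  qed
  finally have sum: "(\<Sum>j. of_nat (m + j) * c j * z ^ j) = z * U' + of_nat m * U z"
    by (simp add: sums_iff)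
  have zm: "z ^ m = z ^ (m - 1) * z"
    using m by (metis power_minus_mult not_one_le_zero not_gr_zero)
  have "((\<lambda>w. w ^ m * U w) has_field_derivative
        z ^ m * U' + of_nat m * z ^ (m - 1) * U z) (at z)"
    by (auto intro!: derivative_eq_intros dU)
  then have "((\<lambda>w. w ^ m * U w) has_field_derivative
        z ^ (m - 1) * (\<Sum>j. of_nat (m + j) * c j * z ^ j)) (at z)"
    unfolding sum zm by (simp add: algebra_simps)
  then show ?thesis
    by (rule has_field_derivative_transform_within_open[OF _ open_ball, of _ _ _ 0 1])
       (use z shift in auto)
qed

text \<open>
  As a limit, \<open>remove_sings\<close> does not see the default value \<open>0\<close> that the quotient takes at the origin
  for \<open>m > 0\<close>.
\<close>

lemma remove_sings_divide_power:
  assumes S: "open S" "z \<in> S" and Q: "Q holomorphic_on S"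
    and g: "\<And>u. u \<in> S \<Longrightarrow> g u = u ^ m * Q u"
  shows "remove_sings (\<lambda>u. g u / u ^ m) z = Q z"
proof (rule remove_sings_eqI)
  have "Q \<midarrow>z\<rightarrow> Q z"
    using Q S by (metis continuous_on_interior holomorphic_on_imp_continuous_on interior_open isContD)
  moreover have "eventually (\<lambda>u. g u / u ^ m = Q u) (at z)"
  proof (cases "z = 0")
    case True
    show ?thesis
      using eventually_at_in_open[OF S] by eventually_elim (use True g in auto)
  next
    case False
    have "eventually (\<lambda>u. u \<in> S \<inter> - {0}) (at z)"
      using S False by (intro eventually_at_in_open') auto
    then show ?thesis
      by eventually_elim (use g in auto)
  qed
  ultimately show "(\<lambda>u. g u / u ^ m) \<midarrow>z\<rightarrow> Q z"
    by (simp add: filterlim_cong)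
qed

section \<open>Subordination of functions with negative coefficients\<close>

lemma subordinate_cong:
  assumes "\<And>z. z \<in> unit_disc \<Longrightarrow> F z = F' z"
  shows "subordinate F G \<longleftrightarrow> subordinate F' G"
  using assms by (simp add: subordinate_def)

text \<open>
  Write \<open>S\<close> for the series. Solving \<open>1 - S = (1 + A w) / (1 + B w)\<close> for \<open>w\<close> gives
  \<open>w = S / (B - A - B S)\<close>, so subordination means \<open>|S| < |B - A - B S|\<close> on the disc.

  On the positive radius \<open>S\<close> is real and nonnegative, and the inequality forces
  \<open>(1 + B) S < B - A\<close>: if \<open>B S \<ge> B - A\<close>, then \<open>|B - A - B S| < B S \<le> S\<close>. Letting the radius
  tend to \<open>1\<close> bounds the sum of the coefficients. Conversely, that bound and \<open>n \<ge> 1\<close>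
  give \<open>|S z| \<le> |z| (B - A) / (1 + B)\<close>, and the triangle inequality yields \<open>|w| < 1\<close>.
\<close>

lemma subordinate_negative_series_iff:
  fixes s :: "nat \<Rightarrow> real" and A B :: real
  assumes n: "n \<ge> 1" and AB: "A < B" "0 < B" "B \<le> 1"
    and s0: "\<And>j. 0 \<le> s j"
    and sm: "\<And>z. cmod z < 1 \<Longrightarrow> summable (\<lambda>j. of_real (s j) * z ^ j :: complex)"
  shows "subordinate (\<lambda>z. 1 - (\<Sum>j. of_real (s j) * z ^ (n + j)))
            (\<lambda>z. (1 + of_real A * z) / (1 + of_real B * z))
      \<longleftrightarrow> summable s \<and> (1 + B) * suminf s \<le> B - A"
    (is "subordinate (\<lambda>z. 1 - ?S z) ?G \<longleftrightarrow> ?R")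
proof
  assume "subordinate (\<lambda>z. 1 - ?S z) ?G"
  then obtain w where w: "\<And>z. z \<in> unit_disc \<Longrightarrow> cmod (w z) < 1"
    and eq: "\<And>z. z \<in> unit_disc \<Longrightarrow> 1 - ?S z = ?G (w z)"
    unfolding subordinate_def by blast
  have rad: "(1 + B) * (\<Sum>j. s j * r ^ (n + j)) < B - A" if r: "0 < r" "r < 1" for r
  proof -
    have "(\<lambda>j. of_real (s j) * of_real r ^ j :: complex) = (\<lambda>j. of_real (s j * r ^ j))"
      by simp
    then have smr: "summable (\<lambda>j. s j * r ^ j)"
      using sm[of "of_real r"] r summable_of_real_iff by (metis abs_of_pos norm_of_real)
    define T where "T = (\<Sum>j. s j * r ^ (n + j))"
    have smr': "summable (\<lambda>j. s j * r ^ (n + j))"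
      using summable_mult[OF smr, of "r ^ n"] by (simp add: power_add algebra_simps)
    have T0: "0 \<le> T"
      unfolding T_def using s0 r by (intro suminf_nonneg[OF smr']) auto
    have ST: "?S (of_real r) = of_real T"
      unfolding T_def suminf_of_real[OF smr'] by simp
    define v where "v = w (of_real r)"
    have v: "cmod v < 1"
      using w[of "of_real r"] r by (simp add: v_def)
    have "cmod (of_real B * v) < 1"
    proof -
      have "cmod (of_real B * v) \<le> cmod v"
        using AB by (simp add: norm_mult mult_left_le_one_le)
      with v show ?thesis by simp
    qed
    then have "1 + of_real B * v \<noteq> 0"
      by (metis add_eq_0_iff norm_minus_cancel norm_one less_irrefl)
    then have "v * of_real (B - A - B * T) = of_real T"
      using eq[of "of_real r"] r ST by (simp add: v_def[symmetric] field_simps) 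
    then have n1: "cmod v * \<bar>B - A - B * T\<bar> = T"
      using T0 by (metis abs_of_nonneg norm_mult norm_of_real)
    have "B - A - B * T \<noteq> 0"
      using n1 AB by auto
    then have "T < \<bar>B - A - B * T\<bar>"
      using n1 v mult_strict_right_mono[of "cmod v" 1 "\<bar>B - A - B * T\<bar>"] by simp
    moreover have "B * T \<le> T"
      using AB T0 by (simp add: mult_left_le_one_le)
    ultimately have "T < B - A - B * T"
      using AB by linarith
    then show ?thesis
      by (simp add: T_def algebra_simps)
  qed
  \<comment> \<open>The series may diverge at radius \<open>1\<close>, so the limit is taken in its partial sums.\<close>
  have part: "(1 + B) * (\<Sum>j<N. s j) \<le> B - A" for N
  proof (rule tendsto_upperbound)
    show "((\<lambda>r. (1 + B) * (\<Sum>j<N. s j * r ^ (n + j))) \<longlongrightarrow> (1 + B) * (\<Sum>j<N. s j)) (at_left 1)"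
      by (auto intro!: tendsto_eq_intros)
    have "eventually (\<lambda>r::real. r \<in> {0<..<1}) (at_left 1)"
      by (intro eventually_at_leftI[of 0]) auto
    then show "\<forall>\<^sub>F r in at_left 1. (1 + B) * (\<Sum>j<N. s j * r ^ (n + j)) \<le> B - A"
    proof eventually_elim
      case (elim r)
      have "(\<lambda>j. of_real (s j) * of_real r ^ j :: complex) = (\<lambda>j. of_real (s j * r ^ j))"
        by simp
      then have "summable (\<lambda>j. s j * r ^ j)"
        using sm[of "of_real r"] elim summable_of_real_iff by (metis abs_of_pos norm_of_real greaterThanLessThan_iff)
      then have "summable (\<lambda>j. s j * r ^ (n + j))"
        using summable_mult[of "\<lambda>j. s j * r ^ j" "r ^ n"] by (simp add: power_add algebra_simps)
      then have "(\<Sum>j<N. s j * r ^ (n + j)) \<le> (\<Sum>j. s j * r ^ (n + j))"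
        using s0 elim by (intro sum_le_suminf) auto
      then have "(1 + B) * (\<Sum>j<N. s j * r ^ (n + j)) \<le> (1 + B) * (\<Sum>j. s j * r ^ (n + j))"
        using AB by (intro mult_left_mono) auto
      then show ?case
        using rad[of r] elim by auto
    qed
  qed auto
  have part': "(\<Sum>j<N. s j) \<le> (B - A) / (1 + B)" for N
    using part[of N] AB by (simp add: field_simps)
  have sums: "summable s"
    using bounded_imp_summable[of s "(B - A) / (1 + B)"] s0 part' 
    by (metis lessThan_Suc_atMost)
  moreover have "suminf s \<le> (B - A) / (1 + B)"
    using suminf_le_const[OF sums] part' by blast
  ultimately show ?R
    using AB by (simp add: field_simps)
next
  assume R: ?R
  then have sms: "summable s" and le: "suminf s \<le> (B - A) / (1 + B)"
    using AB by (auto simp: field_simps)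
  have hS: "?S holomorphic_on unit_disc"
    by (rule holomorphic_onI_DERIV[OF DERIV_power_series_shifted[OF sm _ n]]) auto
  have bound: "(1 + B) * cmod (?S z) < B - A" if z: "z \<in> unit_disc" for z
  proof -
    have le1: "cmod (of_real (s j) * z ^ (n + j)) \<le> cmod z * s j" for j
    proof -
      have "cmod z ^ (n + j) \<le> cmod z ^ 1"
        using z n by (intro power_decreasing) auto
      then show ?thesis
        using s0[of j] mult_left_mono[of "cmod z ^ (n + j)" "cmod z" "s j"] by (simp add: norm_mult norm_power mult.commute)
    qed
    have smz: "summable (\<lambda>j. cmod z * s j)"
      by (rule summable_mult[OF sms])
    have sn: "summable (\<lambda>j. cmod (of_real (s j) * z ^ (n + j)))"
      by (rule summable_comparison_test'[OF smz, of 0]) (use le1 in auto)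
    have "cmod (?S z) \<le> (\<Sum>j. cmod (of_real (s j) * z ^ (n + j)))"
      by (rule summable_norm[OF sn])
    also have "\<dots> \<le> (\<Sum>j. cmod z * s j)"
      by (rule suminf_le[OF le1 sn smz])
    also have "\<dots> = cmod z * suminf s"
      by (rule suminf_mult[OF sms])
    also have "\<dots> \<le> cmod z * ((B - A) / (1 + B))"
      by (intro mult_left_mono le) auto
    also have "\<dots> < 1 * ((B - A) / (1 + B))"
      using z AB by (intro mult_strict_right_mono) auto
    finally show ?thesis
      using AB by (simp add: field_simps)
  qed
  define D where "D z = of_real (B - A) - of_real B * ?S z" for z
  have lt: "cmod (?S z) < cmod (D z)" if z: "z \<in> unit_disc" for z
  proof -
    have "cmod (of_real (B - A) :: complex) - cmod (of_real B * ?S z) \<le> cmod (D z)"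
      unfolding D_def by (rule norm_triangle_ineq2)
    then have "B - A - B * cmod (?S z) \<le> cmod (D z)"
      using AB by (simp add: norm_mult flip: of_real_diff)
    then show ?thesis
      using bound[OF z] by (simp add: algebra_simps)
  qed
  have Dnz: "D z \<noteq> 0" if "z \<in> unit_disc" for z
    using lt[OF that] by auto
  show "subordinate (\<lambda>z. 1 - ?S z) ?G"
    unfolding subordinate_def
  proof (intro exI[of _ "\<lambda>z. ?S z / D z"] conjI ballI)
    show "(\<lambda>z. ?S z / D z) holomorphic_on unit_disc"
      using Dnz by (intro holomorphic_on_divide hS) (auto simp: D_def intro!: holomorphic_intros hS)
    have "(\<lambda>j. of_real (s j) * 0 ^ (n + j)) = (\<lambda>j. 0 :: complex)"
      using n by auto
    then show "?S 0 / D 0 = 0"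
      by simp
    fix z :: complex assume z: "z \<in> unit_disc"
    show "cmod (?S z / D z) < 1"
      using lt[OF z] Dnz[OF z] by (simp add: norm_divide divide_less_eq_1)
    have "1 + of_real B * (?S z / D z) = of_real (B - A) / D z"
      "1 + of_real A * (?S z / D z) = of_real (B - A) * (1 - ?S z) / D z"
      using Dnz[OF z] by (simp_all add: field_simps) (simp_all add: D_def algebra_simps)
    then show "1 - ?S z = ?G (?S z / D z)"
      using Dnz[OF z] AB by simp
  qed
qed

section \<open>The multipliers of the operator\<close>

lemma Phi_nonneg: "0 \<le> Phi p k \<delta> lam mu l"
  by (simp add: Phi_def)

text \<open>
  The quantity raised to the power \<open>\<delta>\<close> in \<open>Phi\<close>; it is the factor by which the coefficient condition
  tightens when \<open>\<delta>\<close> increases by \<open>1\<close>.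
\<close>

definition Phi_base :: "nat \<Rightarrow> nat \<Rightarrow> real \<Rightarrow> real \<Rightarrow> real \<Rightarrow> real" where
  "Phi_base p k lam mu l = ((real k - real p) * (lam * mu * real k + lam - mu) + real p + l) / (real p + l)"

lemma Phi_eq_base_powr: "Phi p k \<delta> lam mu l = Phi_base p k lam mu l powr \<delta>"
  by (simp add: Phi_def Phi_base_def)

context
  fixes n p :: nat and lam mu l :: real
  assumes p: "p \<ge> 1" and par: "mu \<ge> 0" "lam \<ge> mu" "l \<ge> 0"
begin

lemma Phi_base_mono:
  assumes "p \<le> i" "i \<le> k"
  shows "Phi_base p i lam mu l \<le> Phi_base p k lam mu l"
  unfolding Phi_base_def using assms p par
  by (intro divide_right_mono add_right_mono diff_right_mono add_mono mult_mono mult_nonneg_nonneg) 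
     (auto intro!: mult_nonneg_nonneg add_nonneg_nonneg simp: add_diff_eq[symmetric])

lemma Phi_base_ge_1:
  assumes "p \<le> k"
  shows "1 \<le> Phi_base p k lam mu l"
  using Phi_base_mono[OF order_refl assms] p par by (simp add: Phi_base_def)

lemma Phi_Suc_exponent:
  assumes "p \<le> k"
  shows "Phi p k (\<delta> + 1) lam mu l = Phi p k \<delta> lam mu l * Phi_base p k lam mu l"
  using Phi_base_ge_1[OF assms] by (simp add: Phi_eq_base_powr powr_add)

lemma Phi_poly_growth:
  obtains K N where "\<And>k. p \<le> k \<Longrightarrow> Phi p k \<delta> lam mu l \<le> K * real k ^ N"
proof -
  define C where "C = 1 + lam * mu + lam"
  define N where "N = nat \<lceil>\<delta>\<rceil>"
  have N: "\<delta> \<le> real N"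
    unfolding N_def by (rule real_nat_ceiling_ge)
  have "Phi p k \<delta> lam mu l \<le> C ^ N * real k ^ (2 * N)" if k: "p \<le> k" for k
  proof -
    let ?k = "real k"
    have k1: "1 \<le> ?k"
      using k p by simp
    have "Phi_base p k lam mu l = 1 + (?k - real p) * (lam * mu * ?k + lam - mu) / (real p + l)"
      using p par by (simp add: Phi_base_def field_simps)
    also have "(?k - real p) * (lam * mu * ?k + lam - mu) / (real p + l) \<le> (?k - real p) * (lam * mu * ?k + lam - mu) / 1"
      using p par k by (intro divide_left_mono mult_nonneg_nonneg) (auto simp: add_diff_eq[symmetric])
    also have "\<dots> \<le> ?k * (lam * mu * ?k + lam * ?k)"
    proof -
      have "lam * 1 \<le> lam * ?k"
        using par k1 by (intro mult_left_mono) auto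
      then have "lam * mu * ?k + lam - mu \<le> lam * mu * ?k + lam * ?k"
        using par by linarith
      then show ?thesis
        using p par k by (simp, intro mult_mono) (auto simp: add_diff_eq[symmetric])
    qed
    also have "1 + \<dots> \<le> C * ?k ^ 2"
    proof -
      have "1 \<le> ?k ^ 2"
        using k1 by (rule one_le_power)
      then show ?thesis
        by (simp add: C_def power2_eq_square algebra_simps)
    qed
    finally have up: "Phi_base p k lam mu l \<le> C * ?k ^ 2" by simp
    have "Phi p k \<delta> lam mu l \<le> Phi_base p k lam mu l powr real N"
      unfolding Phi_eq_base_powr using Phi_base_ge_1[OF k] N by (intro powr_mono) auto
    also have "\<dots> = Phi_base p k lam mu l ^ N"
      using Phi_base_ge_1[OF k] by (simp add: powr_realpow)
    also have "\<dots> \<le> (C * ?k ^ 2) ^ N"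
      using up Phi_base_ge_1[OF k] by (intro power_mono) auto
    finally show ?thesis
      by (simp add: power_mult_distrib power_mult)
  qed
  then show thesis ..
qed

end

section \<open>Characterisation of the class by coefficients\<close>

lemma class_A_neg_coeff0:
  assumes f: "f \<in> class_A_neg n p" and n: "n \<ge> 1"
  shows "coeff0 f (n + p + j) = - of_real (cmod (coeff0 f (n + p + j)))"
proof -
  have "(\<lambda>j. - of_real (cmod (coeff0 f (n + p + j))) * z ^ (n + p + j)) sums (f z - z ^ p)"
    if "z \<in> unit_disc" for z
    using f that sums_minus[of "\<lambda>j. of_real (cmod (coeff0 f (n + p + j))) * z ^ (n + p + j)" "z ^ p - f z"]
    by (auto simp: class_A_neg_def)
  then show ?thesis
    using coeff0_eqI_tail[of p "n + p" "\<lambda>k. - of_real (cmod (coeff0 f k))" f] n by simp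
qed

text \<open>
  With \<open>a\<^sub>k\<close> the moduli of the coefficients, termwise differentiation gives
  \<open>(J f)' / z\<^bsup>p-1\<^esup> = p - (\<Sum>k\<ge>n+p. k \<Phi>\<^sub>k a\<^sub>k z\<^bsup>k-p\<^esup>)\<close>. Subtracting \<open>\<sigma>\<close> and dividing by \<open>p - \<sigma>\<close>
  turns this into \<open>1\<close> minus a series with nonnegative coefficients, to which
  \<open>subordinate_negative_series_iff\<close> applies. The condition on \<open>t\<close> is written with the weights that
  define the neighbourhoods, so that membership says: the weighted \<open>\<ell>\<^sub>1\<close> norm is at most \<open>1\<close>.
\<close>

theorem class_P_neg_iff_coefficients:
  fixes f :: "complex \<Rightarrow> complex" and lam mu l \<delta> A B \<sigma> :: real
  assumes n: "n \<ge> 1" and p: "p \<ge> 1" and par: "mu \<ge> 0" "lam \<ge> mu" "l \<ge> 0"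
    and AB: "A < B" "0 < B" "B \<le> 1" and \<sigma>: "\<sigma> < real p"
    and f: "f \<in> class_A_neg n p"
  defines "t \<equiv> (\<lambda>j. real (n + p + j) * (1 + B) * Phi p (n + p + j) \<delta> lam mu l / ((B - A) * (real p - \<sigma>))
                   * cmod (coeff0 f (n + p + j)))"
  shows "f \<in> class_P_neg n p lam mu l \<delta> A B \<sigma> \<longleftrightarrow> summable t \<and> suminf t \<le> 1"
proof -
  define m where "m = n + p"
  define a where "a j = cmod (coeff0 f (m + j))" for j
  define s where "s j = real (m + j) * Phi p (m + j) \<delta> lam mu l * a j / (real p - \<sigma>)" for j
  have fA: "f \<in> class_A n p"
    using f by (simp add: class_A_neg_def)
  have co: "coeff0 f (m + j) = - of_real (a j)" for j
    using class_A_neg_coeff0[OF f n] by (simp add: a_def m_def)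
  have sa: "summable (\<lambda>j. of_real (a j) * z ^ j :: complex)" if z: "cmod z < 1" for z
  proof (cases "z = 0")
    case True
    then show ?thesis using sums_summable[OF powser_sums_zero] by simp
  next
    case False
    have "summable (\<lambda>j. of_real (a j) * z ^ (m + j))"
      using f z by (auto simp: class_A_neg_def a_def m_def sums_iff)
    then have "summable (\<lambda>j. inverse (z ^ m) * (of_real (a j) * z ^ (m + j)))"
      by (rule summable_mult)
    then show ?thesis
      using False by (simp add: power_add field_simps)
  qed
  obtain K N where KN: "\<And>k. p \<le> k \<Longrightarrow> Phi p k \<delta> lam mu l \<le> K * real k ^ N"
    using Phi_poly_growth[OF p par] by blast
  define c where "c j = (of_real (Phi p (m + j) \<delta> lam mu l) * of_real (a j) :: complex)" for j
  have \<Phi>: "cmod (of_real (Phi p (m + j) \<delta> lam mu l)) \<le> K * real (j + m) ^ N" for j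
    using KN[of "m + j"] Phi_nonneg[of p "m + j" \<delta> lam mu l] by (simp add: m_def ac_simps)
  have sc: "summable (\<lambda>j. c j * z ^ j)" if "cmod z < 1" for z
    unfolding c_def by (rule summable_poly_growth_mult_in_disc[OF _ \<Phi> that]) (rule sa)
  have sc': "summable (\<lambda>j. of_nat (m + j) * c j * z ^ j)" if "cmod z < 1" for z
    using summable_power_mult_in_disc[OF sc that, of m 1] by (simp add: add.commute)
  let ?V = "\<lambda>z. \<Sum>j. of_nat (m + j) * c j * z ^ j"
  define Q where "Q z = of_nat p - z ^ n * ?V z" for z
  have J: "J_op n p \<delta> lam mu l f z = z ^ p - (\<Sum>j. c j * z ^ (m + j))" if z: "z \<in> unit_disc" for z
  proof -
    have "summable (\<lambda>j. c j * z ^ (m + j))"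
      using summable_mult[OF sc, of z "z ^ m"] z by (simp add: power_add algebra_simps)
    from suminf_minus[OF this] show ?thesis
      by (simp add: J_op_def m_def[symmetric] co c_def)
  qed
  have dJ: "deriv (J_op n p \<delta> lam mu l f) z = z ^ (p - 1) * Q z" if z: "z \<in> unit_disc" for z
  proof -
    have e: "m - 1 = (p - 1) + n"
      using p by (simp add: m_def)
    have "((\<lambda>z. z ^ p - (\<Sum>j. c j * z ^ (m + j))) has_field_derivative
        of_nat p * z ^ (p - 1) - z ^ (m - 1) * ?V z) (at z)"
      using z p by (auto intro!: derivative_eq_intros DERIV_power_series_shifted[OF sc] simp: m_def)
    then have "((\<lambda>z. z ^ p - (\<Sum>j. c j * z ^ (m + j))) has_field_derivative z ^ (p - 1) * Q z) (at z)"
      unfolding e by (simp add: Q_def power_add algebra_simps)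
    then have "(J_op n p \<delta> lam mu l f has_field_derivative z ^ (p - 1) * Q z) (at z)"
      by (rule has_field_derivative_transform_within_open[OF _ open_ball z]) (use J in auto)
    then show ?thesis
      by (rule DERIV_imp_deriv)
  qed
  have "?V holomorphic_on unit_disc"
  proof (rule holomorphic_onI_DERIV)
    fix z :: complex assume "z \<in> unit_disc"
    then obtain r where r: "cmod z < r" "r < 1"
      using dense[of "cmod z" 1] by auto
    have "0 < r"
      using r(1) norm_ge_zero[of z] by linarith
    then show "(?V has_field_derivative (\<Sum>j. diffs (\<lambda>j. of_nat (m + j) * c j) j * z ^ j)) (at z)"
      using r by (intro termdiffs_strong[OF sc', of "of_real r"]) auto
  qed
  then have holQ: "Q holomorphic_on unit_disc"
    unfolding Q_def by (intro holomorphic_on_diff holomorphic_on_mult) (auto intro!: holomorphic_intros)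
  have p\<sigma>: "(of_nat p - of_real \<sigma> :: complex) \<noteq> 0"
    using \<sigma> by (metis of_real_eq_iff of_real_of_nat_eq right_minus_eq less_irrefl)
  have sj: "of_real (s j) = (of_nat (m + j) * c j) / (of_nat p - of_real \<sigma> :: complex)" for j
    by (simp add: s_def c_def)
  have ss: "summable (\<lambda>j. of_real (s j) * z ^ j :: complex)" if "cmod z < 1" for z
    using summable_divide[OF sc'[OF that], of "of_nat p - of_real \<sigma>"] by (simp only: sj times_divide_eq_left)
  have F: "1 / (of_nat p - of_real \<sigma>) *
       (remove_sings (\<lambda>u. deriv (J_op n p \<delta> lam mu l f) u / u ^ (p - 1)) z - of_real \<sigma>)
     = 1 - (\<Sum>j. of_real (s j) * z ^ (n + j))" if z: "z \<in> unit_disc" for z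
  proof -
    have "remove_sings (\<lambda>u. deriv (J_op n p \<delta> lam mu l f) u / u ^ (p - 1)) z = Q z"
      by (rule remove_sings_divide_power[OF open_ball z holQ dJ])
    moreover have "(\<Sum>j. of_real (s j) * z ^ (n + j)) = z ^ n * ?V z / (of_nat p - of_real \<sigma>)"
    proof -
      have "(\<lambda>j. z ^ n / (of_nat p - of_real \<sigma>) * (of_nat (m + j) * c j * z ^ j)) sums (z ^ n / (of_nat p - of_real \<sigma>) * ?V z)"
        using z by (intro sums_mult summable_sums sc') auto
      then show ?thesis
        by (simp add: sj sums_iff power_add field_simps)
    qed
    ultimately show ?thesis
      using p\<sigma> by (simp add: Q_def field_simps)
  qed
  have "f \<in> class_P_neg n p lam mu l \<delta> A B \<sigma> \<longleftrightarrow>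
      subordinate (\<lambda>z. 1 - (\<Sum>j. of_real (s j) * z ^ (n + j))) (\<lambda>z. (1 + of_real A * z) / (1 + of_real B * z))"
    using f fA subordinate_cong[OF F] by (simp add: class_P_neg_def class_P_def)
  also have "\<dots> \<longleftrightarrow> summable s \<and> (1 + B) * suminf s \<le> B - A"
    by (rule subordinate_negative_series_iff[OF n AB _ ss]) (use \<sigma> Phi_nonneg in \<open>auto simp: s_def a_def\<close>)
  also have "\<dots> \<longleftrightarrow> summable t \<and> suminf t \<le> 1"
  proof -
    have t: "t = (\<lambda>j. (1 + B) / (B - A) * s j)"
      by (rule ext) (simp add: t_def s_def a_def m_def field_simps)
    have q: "0 < (1 + B) / (B - A)"
      using AB by auto
    have "summable t \<longleftrightarrow> summable s"
      unfolding t using q by (subst summable_cmult_iff) auto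
    moreover have "suminf t = (1 + B) / (B - A) * suminf s" if "summable s"
      unfolding t by (rule suminf_mult[OF that])
    moreover have "(1 + B) / (B - A) * suminf s \<le> 1 \<longleftrightarrow> (1 + B) * suminf s \<le> B - A"
      using AB by (simp add: field_simps)
    ultimately show ?thesis
      by auto
  qed
  finally show ?thesis .
qed

section \<open>Neighbourhoods and their sharp radius\<close>

theorem theorem4p2:
  fixes n p :: nat and lam mu l \<delta> A B \<sigma> \<eta> :: real
  assumes "n \<ge> 1" and "p \<ge> 1"
    and "mu \<ge> 0" and "lam \<ge> mu" and "l \<ge> 0" and "\<delta> \<ge> 0"
    and "-1 \<le> A" and "A < B" and "0 < B" and "B \<le> 1"
    and "0 \<le> \<sigma>" and "\<sigma> < real p"
    and "\<eta> = real n * (lam * mu * real (n + p) + lam - mu) /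
             (real n * (lam * mu * real (n + p) + lam - mu) + real p + l)"
  shows "(\<forall>f \<in> class_P_neg n p lam mu l (\<delta> + 1) A B \<sigma>.
            nbhd n p lam mu l \<delta> A B \<sigma> \<eta> f \<subseteq> class_P_neg n p lam mu l \<delta> A B \<sigma>) \<and>
         (\<not> (A = -1 \<and> \<sigma> = 0 \<and> (\<delta> = 0 \<or> lam = 0)) \<longrightarrow>
            (\<forall>\<eta>' > \<eta>. \<exists>f \<in> class_P_neg n p lam mu l (\<delta> + 1) A B \<sigma>.
               \<not> nbhd n p lam mu l \<delta> A B \<sigma> \<eta>' f \<subseteq> class_P_neg n p lam mu l \<delta> A B \<sigma>))"
proof -
  note par = assms(3-5)
  define m where "m = n + p"
  define R where "R = Phi_base p m lam mu l"
  define w where "w k = real k * (1 + B) * Phi p k \<delta> lam mu l / ((B - A) * (real p - \<sigma>))" for k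
  have w0: "0 \<le> w k" for k
    using assms Phi_nonneg by (simp add: w_def)
  have R1: "1 \<le> R"
    unfolding R_def by (rule Phi_base_ge_1) (use assms m_def in auto)
  have \<eta>: "\<eta> = 1 - 1 / R"
  proof -
    define X where "X = real n * (lam * mu * real m + lam - mu)"
    have "0 \<le> lam * mu * real m + (lam - mu)"
      using par by (intro add_nonneg_nonneg mult_nonneg_nonneg) auto
    then have "0 \<le> X"
      by (auto simp: X_def add_diff_eq intro: mult_nonneg_nonneg)
    moreover have "0 < real p + l"
      using assms(2) par by simp
    moreover have "R = (X + (real p + l)) / (real p + l)"
      by (simp add: R_def Phi_base_def X_def m_def add.assoc)
    moreover have "\<eta> = X / (X + (real p + l))"
      using assms(13) by (simp add: X_def m_def add.assoc)
    ultimately show ?thesis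
      by (simp add: diff_divide_eq_iff)
  qed
  have P\<delta>: "f \<in> class_P_neg n p lam mu l \<delta> A B \<sigma> \<longleftrightarrow>
      summable (\<lambda>j. w (m + j) * cmod (coeff0 f (m + j))) \<and> (\<Sum>j. w (m + j) * cmod (coeff0 f (m + j))) \<le> 1"
    if "f \<in> class_A_neg n p" for f
    unfolding w_def m_def by (rule class_P_neg_iff_coefficients[OF assms(1,2) par assms(8-10,12) that])
  have P\<delta>1: "f \<in> class_P_neg n p lam mu l (\<delta> + 1) A B \<sigma> \<longleftrightarrow>
      summable (\<lambda>j. w (m + j) * Phi_base p (m + j) lam mu l * cmod (coeff0 f (m + j))) \<and>
      (\<Sum>j. w (m + j) * Phi_base p (m + j) lam mu l * cmod (coeff0 f (m + j))) \<le> 1"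
    if "f \<in> class_A_neg n p" for f
  proof -
    have eq: "real (m + j) * (1 + B) * Phi p (m + j) (\<delta> + 1) lam mu l / ((B - A) * (real p - \<sigma>))
        = w (m + j) * Phi_base p (m + j) lam mu l" for j
      using Phi_Suc_exponent[OF assms(2) par, of "m + j" \<delta>] by (simp add: w_def m_def)
    show ?thesis
      unfolding eq[symmetric] unfolding m_def
      by (rule class_P_neg_iff_coefficients[OF assms(1,2) par assms(8-10,12) that])
  qed
  have nb: "nbhd_term p lam mu l \<delta> A B \<sigma> f g k = w k * \<bar>cmod (coeff0 g k) - cmod (coeff0 f k)\<bar>" for f g k
    by (simp add: nbhd_term_def w_def)
  show ?thesis
  proof (intro conjI ballI subsetI impI allI)
    fix f g assume f: "f \<in> class_P_neg n p lam mu l (\<delta> + 1) A B \<sigma>" and g: "g \<in> nbhd n p lam mu l \<delta> A B \<sigma> \<eta> f"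
    have fneg: "f \<in> class_A_neg n p" and gneg: "g \<in> class_A_neg n p"
      using f g by (auto simp: class_P_neg_def nbhd_def)
    define x where "x j = w (m + j) * cmod (coeff0 f (m + j))" for j
    define y where "y j = w (m + j) * cmod (coeff0 g (m + j))" for j
    define d where "d j = w (m + j) * \<bar>cmod (coeff0 g (m + j)) - cmod (coeff0 f (m + j))\<bar>" for j
    define x' where "x' j = w (m + j) * Phi_base p (m + j) lam mu l * cmod (coeff0 f (m + j))" for j
    have x': "summable x'" "suminf x' \<le> 1"
      using f P\<delta>1[OF fneg] unfolding x'_def by auto
    have d: "summable d" "suminf d \<le> \<eta>"
      using g unfolding nbhd_def nb d_def m_def by auto
    \<comment> \<open>The weights for \<open>\<delta> + 1\<close> are at least \<open>R\<close> times those for \<open>\<delta>\<close>, as \<open>R\<close> is the smallest base.\<close>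
    have Rx: "R * x j \<le> x' j" for j
    proof -
      have "R \<le> Phi_base p (m + j) lam mu l"
        unfolding R_def by (rule Phi_base_mono) (use assms m_def in auto)
      then have "R * x j \<le> Phi_base p (m + j) lam mu l * x j"
        using w0 by (intro mult_right_mono) (auto simp: x_def)
      then show ?thesis
        by (simp add: x_def x'_def mult_ac)
    qed
    have x0: "0 \<le> x j" for j
      using w0 by (simp add: x_def)
    have sRx: "summable (\<lambda>j. R * x j)"
      by (rule summable_comparison_test'[OF x'(1), of 0]) (use Rx x0 R1 in auto)
    then have sx: "summable x"
      using R1 by (simp add: summable_cmult_iff)
    have "R * suminf x \<le> suminf x'"
      using suminf_le[OF Rx sRx x'(1)] suminf_mult[OF sx, of R] by simp
    then have xle: "suminf x \<le> 1 / R"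
      using x'(2) R1 by (simp add: field_simps)
    have yxd: "y j \<le> x j + d j" for j
      using mult_left_mono[OF _ w0[of "m + j"], of "cmod (coeff0 g (m + j))"
          "cmod (coeff0 f (m + j)) + \<bar>cmod (coeff0 g (m + j)) - cmod (coeff0 f (m + j))\<bar>"]
      by (simp add: x_def y_def d_def algebra_simps)
    have sy: "summable y"
      by (rule summable_comparison_test'[OF summable_add[OF sx d(1)], of 0]) (use yxd w0 in \<open>auto simp: y_def\<close>)
    have "suminf y \<le> suminf x + suminf d"
      using suminf_le[OF yxd sy summable_add[OF sx d(1)]] suminf_add[OF sx d(1)] by simp
    then have "suminf y \<le> 1"
      using xle d(2) \<eta> by simp
    then show "g \<in> class_P_neg n p lam mu l \<delta> A B \<sigma>"
      using P\<delta>[OF gneg] sy unfolding y_def by simp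
  next
    fix \<eta>' assume ex: "\<not> (A = -1 \<and> \<sigma> = 0 \<and> (\<delta> = 0 \<or> lam = 0))" and \<eta>': "\<eta> < \<eta>'"
    have \<Phi>: "Phi p m \<delta> lam mu l = R powr \<delta>"
      by (simp add: Phi_eq_base_powr R_def)
    have \<Phi>1: "1 \<le> R powr \<delta>"
      using R1 assms by (simp add: ge_one_powr_ge_zero)
    have wm: "0 < w m"
      using assms \<Phi> \<Phi>1 by (auto simp: w_def m_def intro!: divide_pos_pos mult_pos_pos)
    \<comment> \<open>A coefficient \<open>b\<close> at \<open>m\<close> of weight \<open>w m * b = c\<close> has \<open>m b = C c\<close>, so the strict inequality \<open>C < p\<close>
      leaves room for weights slightly above \<open>1\<close> within the valence condition \<open>m b \<le> p\<close>.\<close>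
    define C where "C = real m / w m"
    have C0: "0 < C"
      using wm assms by (simp add: C_def m_def)
    have C: "C = (B - A) / (1 + B) * (real p - \<sigma>) / R powr \<delta>"
    proof -
      have "real m \<noteq> 0" "1 + B \<noteq> 0" "B - A \<noteq> 0" "real p - \<sigma> \<noteq> 0" "R powr \<delta> \<noteq> 0"
        using assms(1,8,9,12) \<Phi>1 by (auto simp: m_def)
      then show ?thesis
        unfolding C_def w_def \<Phi> by simp
    qed
    have Cp: "C < real p"
    proof -
      define q where "q = (B - A) / (1 + B)"
      have q: "0 < q" "q \<le> 1"
        using assms by (auto simp: q_def)
      have "C \<le> q * (real p - \<sigma>)"
        using divide_left_mono[OF \<Phi>1, of "q * (real p - \<sigma>)"] q \<Phi>1 R1 assms(12)
        by (simp add: C q_def[symmetric])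
      moreover have "q * (real p - \<sigma>) \<le> real p - \<sigma>"
        using q assms by (intro mult_left_le_one_le) auto
      moreover have "C < q * (real p - \<sigma>)" if "1 < R powr \<delta>"
        using q that assms by (simp add: C q_def[symmetric] divide_less_eq)
      moreover have "q * (real p - \<sigma>) < real p - \<sigma>" if "q < 1"
        using that assms by simp
      moreover have "q < 1" if "A \<noteq> -1"
        using that assms by (simp add: q_def)
      moreover have "1 < R powr \<delta>" if "\<delta> \<noteq> 0" "lam \<noteq> 0"
      proof -
        have "0 < lam * mu * real m + (lam - mu)"
          using that par assms(1,2) by (cases "mu = 0") (auto simp: m_def intro!: add_pos_nonneg mult_pos_pos)
        then have "0 < real n * (lam * mu * real m + lam - mu)"
          using assms(1) by (simp add: add_diff_eq)
        then have "1 < R"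
          using assms(2) par by (simp add: R_def Phi_base_def m_def)
        then show ?thesis
          using powr_less_mono[of 0 \<delta> R] that(1) assms(6) by simp
      qed
      ultimately show ?thesis
        using ex assms by fastforce
    qed
    define q where "q = real p / C"
    have q: "1 < q"
      using C0 Cp by (simp add: q_def)
    \<comment> \<open>The distance \<open>e\<close> between the two functions must exceed \<open>\<eta>\<close>, yet stay so small that the second
      one is still \<open>p\<close>-valent, that is \<open>1 - \<eta> + e \<le> q\<close>.\<close>
    obtain e where e: "\<eta> < e" "e < min \<eta>' (\<eta> + (q - 1))"
      using dense[of \<eta> "min \<eta>' (\<eta> + (q - 1))"] \<eta>' q by auto
    have \<eta>0: "0 \<le> \<eta>"
      using \<eta> R1 by simp
    define a where "a = 1 / (w m * R)"
    define b where "b = a + e / w m"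
    have a0: "0 \<le> a" and ab: "a \<le> b" "0 \<le> b"
      using wm R1 e \<eta>0 by (auto simp: a_def b_def)
    have "real m * b = C * (1 - \<eta> + e)"
      using wm R1 by (simp add: b_def a_def C_def \<eta> field_simps)
    also have "\<dots> \<le> C * q"
      using C0 e by (intro mult_left_mono) auto
    also have "\<dots> = real p"
      using C0 by (simp add: q_def)
    finally have mb: "real m * b \<le> real p" .
    have ma: "real m * a \<le> real p"
      using mult_left_mono[OF ab(1), of "real m"] mb by simp
    define f :: "complex \<Rightarrow> complex" where "f = (\<lambda>z. z ^ p - of_real a * z ^ (n + p))"
    define g :: "complex \<Rightarrow> complex" where "g = (\<lambda>z. z ^ p - of_real b * z ^ (n + p))"
    have f: "f \<in> class_A_neg n p" "\<And>j. cmod (coeff0 f (m + j)) = (if j = 0 then a else 0)"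
      using binomial_in_class_A_neg[OF assms(1,2) a0] ma a0 by (auto simp: f_def m_def)
    have g: "g \<in> class_A_neg n p" "\<And>j. cmod (coeff0 g (m + j)) = (if j = 0 then b else 0)"
      using binomial_in_class_A_neg[OF assms(1,2) ab(2)] mb ab by (auto simp: g_def m_def)
    have single: "summable h \<and> suminf h = h 0" if "\<And>j. j \<noteq> 0 \<Longrightarrow> h j = 0" for h :: "nat \<Rightarrow> real"
      using sums_finite[of "{0}" h] that by (auto simp: sums_iff)
    have "f \<in> class_P_neg n p lam mu l (\<delta> + 1) A B \<sigma>"
    proof -
      have "w m * R * a = 1"
        using wm R1 by (simp add: a_def)
      then show ?thesis
        unfolding P\<delta>1[OF f(1)] f(2)
        using single[of "\<lambda>j. w (m + j) * Phi_base p (m + j) lam mu l * (if j = 0 then a else 0)"] by (simp add: R_def)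
    qed
    moreover have "g \<in> nbhd n p lam mu l \<delta> A B \<sigma> \<eta>' f"
    proof -
      have "w m * \<bar>b - a\<bar> \<le> \<eta>'"
        using wm e \<eta>0 by (simp add: b_def)
      then show ?thesis
        unfolding nbhd_def mem_Collect_eq nb m_def[symmetric] f(2) g(2)
        using g(1) single[of "\<lambda>j. w (m + j) * \<bar>(if j = 0 then b else 0) - (if j = 0 then a else 0)\<bar>"] by simp
    qed
    moreover have "g \<notin> class_P_neg n p lam mu l \<delta> A B \<sigma>"
    proof -
      have "w m * b = 1 / R + e"
        using wm R1 by (simp add: b_def a_def field_simps)
      then have "1 < w m * b"
        using e \<eta> by simp
      then show ?thesis
        unfolding P\<delta>[OF g(1)] g(2)
        using single[of "\<lambda>j. w (m + j) * (if j = 0 then b else 0)"] by simp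
    qed
    ultimately show "\<exists>f \<in> class_P_neg n p lam mu l (\<delta> + 1) A B \<sigma>.
        \<not> nbhd n p lam mu l \<delta> A B \<sigma> \<eta>' f \<subseteq> class_P_neg n p lam mu l \<delta> A B \<sigma>"
      by blast
  qed
qed

end
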